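(* Let $q$ be a prime power, $m$ a positive integer, $s$ a positive integer and $k=2s+1$. Let $S$ be an $\mathbb{F}_q$-subspace of $\mathbb{F}_{q^m}$ of dimension $i$ and \[U=\{(x_1+\zeta,x_1^q,x_1^{q^2},x_2,x_2^q,\ldots,x_s,x_s^q) : x_1,\ldots,x_s\in\mathbb{F}_{q^m},\ \zeta\in S\}\subseteq\mathbb{F}_{q^m}^k.\] Then for every hyperplane $H$ of $\mathrm{PG}(k-1,q^m)$, \[ w_{L_U}(H)\in\left\{\frac{m(k-3)}{2}+i,\ \frac{m(k-3)}{2}+i+1,\ \frac{m(k-3)}{2}+i+2\right\}.\]
   Context: $L_U=\{\langle u\rangle_{\mathbb{F}_{q^m}} : u\in U\setminus\{0\}\}$; for an $\mathbb{F}_{q^m}$-subspace $T$, the weight of $\mathrm{PG}(T,\mathbb{F}_{q^m})$ is $w_{L_U}(\mathrm{PG}(T,\mathbb{F}_{q^m}))=\dim_{\mathbb{F}_q}(U\cap T)$. *)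

theory Defs
  imports
    "Jordan_Normal_Form.VS_Connect"
    "HOL-Algebra.Subrings"
    "HOL-Number_Theory.Prime_Powers"
begin

hide_const (open) Multiset.mult Polynomial.smult

text \<open>
  The big field is a finite field type \<open>'a\<close>, seen as the ring \<^term>\<open>class_ring\<close>; the small
  field is a subset \<open>F\<close> of it that is a subfield. Since the operations are the same, restricting
  scalars to \<open>F\<close> only changes the carrier of the scalar ring.
\<close>

definition subfield_ring :: "'a::field set \<Rightarrow> 'a ring" where
  "subfield_ring F = class_ring\<lparr>carrier := F\<rparr>"

definition self_module :: "('a::field, 'a) module" where
  "self_module = \<lparr>carrier = UNIV, mult = (*), one = 1, zero = 0, add = (+), smult = (*)\<rparr>"

definition dim_over :: "'a ring \<Rightarrow> ('a, 'b) module \<Rightarrow> 'b set \<Rightarrow> nat" where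
  "dim_over K V W = vectorspace.dim K (V\<lparr>carrier := W\<rparr>)"

text \<open>
  A hyperplane of the projective space of \<open>'a\<^sup>k\<close> is represented by its underlying vector subspace.
\<close>

definition is_hyperplane :: "nat \<Rightarrow> 'a::field vec set \<Rightarrow> bool" where
  "is_hyperplane k T \<longleftrightarrow>
     VectorSpace.subspace class_ring T (module_vec TYPE('a) k) \<and>
     dim_over class_ring (module_vec TYPE('a) k) T = k - 1"

text \<open>
  The weight, with respect to the linear set of \<open>U\<close>, of the projective subspace
  with underlying vector subspace \<open>T\<close>.
\<close>

definition weight :: "'a::field set \<Rightarrow> nat \<Rightarrow> 'a vec set \<Rightarrow> 'a vec set \<Rightarrow> nat" where
  "weight F k U T = dim_over (subfield_ring F) (module_vec TYPE('a) k) (U \<inter> T)"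

text \<open>Only the values \<open>x 1, \<dots>, x s\<close> of the function \<open>x\<close> matter (for \<open>s \<ge> 1\<close>).\<close>

definition U_space :: "nat \<Rightarrow> nat \<Rightarrow> 'a::field set \<Rightarrow> 'a vec set" where
  "U_space q s S =
     {vec_of_list ([x 1 + \<zeta>, x 1 ^ q, x 1 ^ (q ^ 2)]
        @ concat (map (\<lambda>j. [x j, x j ^ q]) [2..<s + 1])) | (x :: nat \<Rightarrow> 'a) \<zeta>. \<zeta> \<in> S}"

text \<open>
  The library constant \<^term>\<open>vectorspace.dim\<close> is meaningful only for a vector space; the ambient
  spaces used above are vector spaces over \<open>F\<close>, and \<open>U\<close> lies in \<open>'a\<^sup>2\<^sup>s\<^sup>+\<^sup>1\<close>.
\<close>

lemma field_subfield_ring: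
  assumes "subfield F (class_ring :: 'a::field ring)"
  shows "field (subfield_ring F)"
  unfolding subfield_ring_def
  using ring.subfield_iff(2)[OF class_ring.ring_axioms] assms by blast

lemma vectorspace_self_module:
  fixes F :: "'a::field set"
  assumes "subfield F class_ring"
  shows "vectorspace (subfield_ring F) self_module"
proof -
  interpret K: field "subfield_ring F" by (rule field_subfield_ring[OF assms])
  have "abelian_group (self_module :: ('a, 'a) module)"
  proof (rule abelian_groupI)
    fix x :: 'a
    show "\<exists>y\<in>carrier self_module. y \<oplus>\<^bsub>self_module\<^esub> x = \<zero>\<^bsub>self_module\<^esub>"
      by (rule bexI[of _ "- x"]) (simp_all add: self_module_def)
  qed (simp_all add: self_module_def algebra_simps)
  then have "Module.module (subfield_ring F) (self_module :: ('a, 'a) module)"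
    by (rule Module.moduleI[OF K.is_cring])
       (simp_all add: self_module_def subfield_ring_def algebra_simps)
  then show ?thesis
    by (simp add: vectorspace_def K.field_axioms)
qed

lemma vectorspace_module_vec:
  fixes F :: "'a::field set"
  assumes "subfield F class_ring"
  shows "vectorspace (subfield_ring F) (module_vec TYPE('a) k)"
proof -
  interpret K: field "subfield_ring F" by (rule field_subfield_ring[OF assms])
  have "Module.module (subfield_ring F) (module_vec TYPE('a) k)"
    by (rule Module.moduleI[OF K.is_cring Module.module.axioms(2)[OF vec_module]])
       (simp_all add: module_vec_simps subfield_ring_def add_smult_distrib_vec smult_add_distrib_vec
          smult_smult_assoc)
  then show ?thesis
    by (simp add: vectorspace_def K.field_axioms)
qed

lemma U_space_carrier:
  assumes "s > 0"
  shows "U_space q s S \<subseteq> carrier_vec (2 * s + 1)"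
proof -
  have len: "length (concat (map (\<lambda>j. [x j, x j ^ q]) [2..<s + 1])) = 2 * (s - 1)"
    for x :: "nat \<Rightarrow> 'a"
    using assms by (induction s) auto
  have "vec_of_list ([x 1 + \<zeta>, x 1 ^ q, x 1 ^ (q ^ 2)]
        @ concat (map (\<lambda>j. [x j, x j ^ q]) [2..<s + 1])) \<in> carrier_vec (2 * s + 1)"
    for x :: "nat \<Rightarrow> 'a" and \<zeta>
    by (rule carrier_vecI, unfold dim_vec_of_list length_append len) (use assms in simp)
  then show ?thesis
    unfolding U_space_def by blast
qed

end

theory Submission
  imports Defs "HOL-Number_Theory.Residues"
begin

text \<open>
  The argument is a count. Since \<open>T\<close> is the kernel of a nonzero functional \<open>v \<mapsto> a \<bullet> v\<close>, the size
  \<open>|U| = q\<^bsup>sm+i\<^esup>\<close> is the product of \<open>|U \<inter> T|\<close> and \<open>|a \<bullet> U|\<close>. Trivially \<open>|a \<bullet> U| \<le> q\<^sup>m\<close>. Letting only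
  one suitable \<open>x\<^sub>j\<close> vary and taking \<open>\<zeta> = 0\<close> shows that \<open>a \<bullet> U\<close> contains the image of a nonzero
  additive polynomial \<open>b t + c t\<^sup>q + d t\<^bsup>q\<^sup>2\<^esup>\<close>. It has at most \<open>q\<^sup>2\<close> roots, hence
  \<open>|a \<bullet> U| \<ge> q\<^bsup>m-2\<^esup>\<close>.
\<close>


section \<open>Counting in finite vector spaces and groups\<close>

text \<open>A finite carrier generates itself, so a finite basis \<open>B\<close> exists. Uniqueness
  of coordinates then makes \<open>lincomb\<close> a bijection from the coefficient functions on
  \<open>B\<close> to the vectors.\<close>

lemma (in vectorspace) card_carrier_eq_power_dim:
  assumes "finite (carrier V)"
  shows "card (carrier V) = card (carrier K) ^ dim"
proof -
  have "gen_set (carrier V)"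
    using span_is_subset2[of "carrier V"] in_own_span[of "carrier V"] by auto
  then have "fin_dim"
    unfolding fin_dim_def using assms by blast
  then obtain B where B: "finite B" "basis B"
    using finite_basis_exists by blast
  then have BV: "B \<subseteq> carrier V" by (simp add: basis_def)
  have "bij_betw (\<lambda>a. lincomb a B) (B \<rightarrow>\<^sub>E carrier K) (carrier V)"
  proof (rule bij_betwI')
    fix a b assume "a \<in> B \<rightarrow>\<^sub>E carrier K" "b \<in> B \<rightarrow>\<^sub>E carrier K"
    moreover from this have "lincomb a B \<in> carrier V"
      using BV by (auto intro!: lincomb_closed)
    ultimately show "(lincomb a B = lincomb b B) = (a = b)"
      using basis_criterion[OF B(1) BV] B(2) by metis
  next
    fix a assume "a \<in> B \<rightarrow>\<^sub>E carrier K"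
    then show "lincomb a B \<in> carrier V"
      using BV by (auto intro!: lincomb_closed)
  next
    fix v assume "v \<in> carrier V"
    then show "\<exists>a\<in>B \<rightarrow>\<^sub>E carrier K. v = lincomb a B"
      using basis_criterion[OF B(1) BV] B(2) by metis
  qed
  then have "card (carrier V) = card (B \<rightarrow>\<^sub>E carrier K)"
    by (simp add: bij_betw_same_card)
  also have "\<dots> = card (carrier K) ^ dim"
    using B by (simp add: card_PiE dim_basis)
  finally show ?thesis .
qed

lemma card_subspace_eq_power_dim_over:
  assumes "vectorspace K V" "VectorSpace.subspace K W V" "finite W"
  shows "card W = card (carrier K) ^ dim_over K V W"
proof -
  interpret W: vectorspace K "V\<lparr>carrier := W\<rparr>"
    by (rule vectorspace.subspace_is_vs[OF assms(1,2)])
  show ?thesis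
    using W.card_carrier_eq_power_dim assms(3) by (simp add: dim_over_def)
qed

text \<open>Every nonempty fibre of an additive map is a translate of its kernel, so all fibres over
  the image have the same size.\<close>

lemma (in abelian_group) card_carrier_eq_image_times_kernel:
  fixes f :: "'a \<Rightarrow> 'c::ab_group_add"
  assumes "finite (carrier G)"
    and add: "\<And>x y. x \<in> carrier G \<Longrightarrow> y \<in> carrier G \<Longrightarrow> f (x \<oplus> y) = f x + f y"
  shows "card (carrier G) = card (f ` carrier G) * card {x \<in> carrier G. f x = 0}"
proof -
  have "card {x \<in> carrier G. f x = y} = card {x \<in> carrier G. f x = 0}"
    if "y \<in> f ` carrier G" for y
  proof -
    from that obtain u where u: "u \<in> carrier G" "y = f u" by auto
    have neg: "f (\<ominus> u) = - f u"
    proof -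
      have "f \<zero> + f \<zero> = f \<zero>" using add[of \<zero> \<zero>] by simp
      then have "f (u \<oplus> \<ominus> u) = 0" using u by (simp add: r_neg)
      then show ?thesis using add[of u "\<ominus> u"] u by (simp add: eq_neg_iff_add_eq_0 add.commute)
    qed
    have "bij_betw (\<lambda>x. x \<oplus> u) {x \<in> carrier G. f x = 0} {x \<in> carrier G. f x = y}"
      by (rule bij_betw_byWitness[where f' = "\<lambda>x. x \<oplus> \<ominus> u"])
         (use u neg in \<open>auto simp: add a_assoc r_neg l_neg\<close>)
    then show ?thesis by (simp add: bij_betw_same_card)
  qed
  moreover have "card (carrier G) = (\<Sum>y\<in>f ` carrier G. card {x \<in> carrier G. f x = y})"
    using sum_fun_comp[of "carrier G" "f ` carrier G" f "\<lambda>_. 1::nat"] assms(1) by simp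
  ultimately show ?thesis by simp
qed

section \<open>Frobenius powers and q-polynomials\<close>

text \<open>The characteristic divides the order \<open>q ^ m\<close> of the field, so it is the
  prime below \<open>q\<close>, and raising to the power \<open>q\<close> is an iterated Frobenius
  map.\<close>

lemma field_power_primepow_add:
  fixes x y :: "'a::{field,finite}"
  assumes "primepow q" "card (UNIV :: 'a set) = q ^ m"
  shows "(x + y) ^ q = x ^ q + y ^ q"
proof -
  obtain p n where p: "prime p" "q = p ^ n"
    using assms(1) by (auto simp: primepow_def)
  have prime: "prime CHAR('a)"
    by (simp add: prime_CHAR_semidom finite_imp_CHAR_pos)
  have "CHAR('a) dvd q ^ m"
    using CHAR_dvd_CARD[where ?'a = 'a] assms(2) by simp
  then have "CHAR('a) = p"
    using p prime by (metis prime_dvd_power primes_dvd_imp_eq)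
  then show ?thesis
    using freshmans_dream'[OF prime, of q n x y] p(2) by simp
qed

text \<open>Multiplication by a nonzero \<open>c\<close> permutes \<open>F - {0}\<close>. Comparing
  the product of all nonzero elements before and after gives
  \<open>c ^ (card F - 1) = 1\<close>.\<close>

lemma subfield_power_card:
  fixes F :: "'a::{field,finite} set"
  assumes F: "subfield F class_ring" and c: "c \<in> F"
  shows "c ^ card F = c"
proof (cases "c = 0")
  case True
  \<comment> \<open>Since \<open>c\<close> lies in \<open>F\<close>, the exponent is positive; this
    rules out \<open>0 ^ 0 = 1\<close>.\<close>
  then show ?thesis using c by (auto simp: card_gt_0_iff intro!: zero_power)
next
  case False
  interpret F: subfield F class_ring by (rule F)
  have mult: "x * y \<in> F" if "x \<in> F" "y \<in> F" for x y
    using F.m_closed that by simp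
  have inv: "inverse x \<in> F" if "x \<in> F" "x \<noteq> 0" for x
  proof -
    have "inv\<^bsub>class_ring\<^esub> x \<in> F - {0}"
      using ring.subfield_m_inv(1)[OF class_ring.ring_axioms F, of x] that by simp
    then show ?thesis using that by (simp add: class_ring_simps)
  qed
  let ?P = "\<Prod>x\<in>F - {0}. x"
  have "bij_betw (\<lambda>x. c * x) (F - {0}) (F - {0})"
    by (rule bij_betw_byWitness[where f' = "\<lambda>x. inverse c * x"])
       (use False in \<open>auto simp: mult.assoc[symmetric] intro: mult c inv\<close>)
  then have "?P = (\<Prod>x\<in>F - {0}. c * x)"
    by (rule prod.reindex_bij_betw[symmetric])
  also have "\<dots> = c ^ card (F - {0}) * ?P"
    by (simp add: prod.distrib)
  finally have "c ^ card (F - {0}) = 1" by simp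
  moreover have "card F = Suc (card (F - {0}))"
    using card.remove[of F 0] subringE(2)[OF subfieldE(1)[OF F]] by simp
  ultimately show ?thesis by simp
qed

text \<open>For \<open>q \<ge> 2\<close> the exponents 1, \<open>q\<close>, \<open>q ^ 2\<close> are
  distinct, so no two coefficients merge and cancel: the polynomial is nonzero of degree at most
  \<open>q ^ 2\<close>.\<close>

lemma card_roots_q_polynomial_le:
  fixes a b c :: "'a::field"
  assumes "q \<ge> 2" "a \<noteq> 0 \<or> b \<noteq> 0 \<or> c \<noteq> 0"
  shows "card {x. a * x + b * x ^ q + c * x ^ (q ^ 2) = 0} \<le> q ^ 2"
proof -
  let ?p = "Polynomial.monom a 1 + Polynomial.monom b q + Polynomial.monom c (q ^ 2)"
  have ne: "q \<noteq> 1" "q ^ 2 \<noteq> 1" "q ^ 2 \<noteq> q"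
    using assms(1) by (auto simp: power2_eq_square)
  have "Polynomial.coeff ?p 1 = a" "Polynomial.coeff ?p q = b" "Polynomial.coeff ?p (q ^ 2) = c"
    using ne ne(2)[symmetric] by auto
  then have "?p \<noteq> 0" using assms(2) by (metis coeff_0)
  then have "card {x. poly ?p x = 0} \<le> degree ?p" by (rule card_poly_roots_bound)
  also have "degree ?p \<le> q ^ 2"
    by (intro degree_add_le order.trans[OF degree_monom_le])
       (use assms(1) in \<open>auto simp: power2_eq_square\<close>)
  finally show ?thesis by (simp add: poly_monom)
qed

section \<open>Hyperplanes as kernels of functionals\<close>

lemma linear_functional_eq_scalar_prod:
  fixes f :: "'a::field vec \<Rightarrow> 'a"
  assumes add: "\<And>v w. v \<in> carrier_vec k \<Longrightarrow> w \<in> carrier_vec k \<Longrightarrow> f (v + w) = f v + f w"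
    and smult: "\<And>c v. v \<in> carrier_vec k \<Longrightarrow> f (c \<cdot>\<^sub>v v) = c * f v"
    and w: "w \<in> carrier_vec k"
  shows "f w = vec k (\<lambda>j. f (unit_vec k j)) \<bullet> w"
proof -
  \<comment> \<open>The truncations lead from the zero vector to \<open>w\<close>, gaining one
    multiple of a unit vector at each step, so the expansion of \<open>f w\<close> follows by
    induction.\<close>
  define trunc where "trunc n = vec k (\<lambda>j. if j < n then w $ j else 0)" for n
  have "f (trunc n) = (\<Sum>j<n. w $ j * f (unit_vec k j))" if "n \<le> k" for n
    using that
  proof (induction n)
    case 0
    have "trunc 0 = 0 \<cdot>\<^sub>v w"
      using w by (intro eq_vecI) (auto simp: trunc_def)
    then show ?case using smult[OF w, of 0] by simp
  next
    case (Suc n)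
    have "trunc (Suc n) = trunc n + w $ n \<cdot>\<^sub>v unit_vec k n"
      using Suc.prems by (intro eq_vecI) (auto simp: trunc_def less_Suc_eq)
    then show ?case
      using Suc by (simp add: add smult trunc_def)
  qed
  from this[of k] have "f (trunc k) = (\<Sum>j<k. w $ j * f (unit_vec k j))" by simp
  moreover have "trunc k = w"
    using w by (intro eq_vecI) (auto simp: trunc_def)
  ultimately show ?thesis
    using w by (auto simp: scalar_prod_def mult.commute lessThan_atLeast0 intro!: sum.cong)
qed

lemma finite_carrier_vec: "finite (carrier_vec n :: 'a::finite vec set)"
proof -
  have "v \<in> vec_of_list ` {xs. set xs \<subseteq> UNIV \<and> length xs = n}" if "v \<in> carrier_vec n" for v :: "'a vec"
    using that by (intro image_eqI[where x = "list_of_vec v"]) (auto simp: vec_list)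
  moreover have "finite {xs :: 'a list. set xs \<subseteq> UNIV \<and> length xs = n}"
    by (rule finite_lists_length_eq) simp
  ultimately show ?thesis
    by (meson finite_imageI finite_subset subsetI)
qed

lemma card_carrier_vec:
  "card (carrier_vec n :: 'a::{field,finite} vec set) = card (UNIV :: 'a set) ^ n"
proof -
  interpret vec_space "TYPE('a)" n .
  show ?thesis
    using card_carrier_eq_power_dim finite_carrier_vec[of n, where ?'a = 'a] dim_is_n by simp
qed

text \<open>Fix \<open>v\<close> outside \<open>T\<close>. A count shows that each \<open>w\<close>
  can be moved into \<open>T\<close> by exactly one multiple of \<open>v\<close>; the scalar needed
  depends linearly on \<open>w\<close> and vanishes exactly on \<open>T\<close>.\<close>

lemma hyperplane_eq_orthogonal_complement:
  fixes T :: "'a::{field,finite} vec set"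
  assumes T: "is_hyperplane k T" and "k > 0"
  obtains a where "a \<in> carrier_vec k" "a \<noteq> 0\<^sub>v k" "T = {v \<in> carrier_vec k. a \<bullet> v = 0}"
proof -
  let ?Q = "card (UNIV :: 'a set)"
  have sub: "VectorSpace.subspace class_ring T (module_vec TYPE('a) k)"
    and dim: "dim_over class_ring (module_vec TYPE('a) k) T = k - 1"
    using T by (auto simp: is_hyperplane_def)
  interpret T: submodule class_ring T "module_vec TYPE('a) k"
    using sub by (simp add: VectorSpace.subspace_def)
  have T_carrier: "T \<subseteq> carrier_vec k" using T.subset by (simp add: module_vec_simps)
  have T_add: "v + w \<in> T" if "v \<in> T" "w \<in> T" for v w
    using T.m_closed that by (simp add: module_vec_simps)
  have T_smult: "c \<cdot>\<^sub>v v \<in> T" if "v \<in> T" for c v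
    using T.smult_closed[of c v] that by (simp add: module_vec_simps)
  have finT: "finite T" using T_carrier finite_carrier_vec finite_subset by blast
  have cardT: "card T = ?Q ^ (k - 1)"
    using card_subspace_eq_power_dim_over[OF vec_vs sub finT] dim by simp
  \<comment> \<open>A field has at least two elements, so its powers increase strictly and
    \<open>T\<close> is proper.\<close>
  have "card {0, 1 :: 'a} \<le> ?Q" by (rule card_mono) auto
  then have "?Q ^ (k - 1) < ?Q ^ k"
    using \<open>k > 0\<close> by (intro power_strict_increasing) auto
  then have "T \<noteq> carrier_vec k"
    using cardT card_carrier_vec[of k, where ?'a = 'a] by auto
  then obtain v where v: "v \<in> carrier_vec k" "v \<notin> T" using T_carrier by blast
  \<comment> \<open>Two different scalars would put a nonzero multiple of \<open>v\<close>, hence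
    \<open>v\<close> itself, into \<open>T\<close>.\<close>
  have uniq: "c = d" if w: "w \<in> carrier_vec k" and cd: "w + c \<cdot>\<^sub>v v \<in> T" "w + d \<cdot>\<^sub>v v \<in> T" for w c d
  proof (rule ccontr)
    assume ne: "c \<noteq> d"
    have "inverse (c - d) \<cdot>\<^sub>v ((w + c \<cdot>\<^sub>v v) + (-1) \<cdot>\<^sub>v (w + d \<cdot>\<^sub>v v)) \<in> T"
      by (rule T_smult[OF T_add[OF cd(1) T_smult[OF cd(2)]]])
    also have "inverse (c - d) \<cdot>\<^sub>v ((w + c \<cdot>\<^sub>v v) + (-1) \<cdot>\<^sub>v (w + d \<cdot>\<^sub>v v)) = v"
      using w v ne by (intro eq_vecI) (auto simp: field_simps)
    finally show False using v by simp
  qed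
  have ex: "\<exists>c. w + c \<cdot>\<^sub>v v \<in> T" if w: "w \<in> carrier_vec k" for w
  proof -
    \<comment> \<open>By \<open>uniq\<close> this map is injective on pairs. Their number
      \<open>?Q ^ (k - 1) * ?Q\<close> is the size of the whole space, so the map is onto;
      \<open>w = t + c v\<close> then gives the scalar \<open>- c\<close>.\<close>
    let ?g = "\<lambda>(t, c). t + c \<cdot>\<^sub>v v"
    have shift: "(t + c \<cdot>\<^sub>v v) + (- c) \<cdot>\<^sub>v v = t" if "t \<in> T" for t c
      using that T_carrier v by (intro eq_vecI) auto
    have "inj_on ?g (T \<times> UNIV)"
    proof (rule inj_onI, clarify)
      fix t t' c c'
      assume t: "t \<in> T" "t' \<in> T" and eq: "t + c \<cdot>\<^sub>v v = t' + c' \<cdot>\<^sub>v v"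
      have "- c = - c'"
      proof (rule uniq[of "t + c \<cdot>\<^sub>v v"])
        show "t + c \<cdot>\<^sub>v v \<in> carrier_vec k" using subsetD[OF T_carrier t(1)] v(1) by simp
        show "t + c \<cdot>\<^sub>v v + (- c) \<cdot>\<^sub>v v \<in> T" unfolding shift[OF t(1)] by (rule t)
        show "t + c \<cdot>\<^sub>v v + (- c') \<cdot>\<^sub>v v \<in> T" unfolding eq shift[OF t(2)] by (rule t)
      qed
      then have c: "c = c'" by simp
      have "t + c \<cdot>\<^sub>v v + (- c) \<cdot>\<^sub>v v = t' + c' \<cdot>\<^sub>v v + (- c') \<cdot>\<^sub>v v"
        by (simp only: eq[unfolded c] c)
      then have "t = t'" by (simp only: shift[OF t(1)] shift[OF t(2)])
      with c show "t = t' \<and> c = c'" by simp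
    qed
    then have "card (?g ` (T \<times> UNIV)) = card T * ?Q"
      by (simp add: card_image card_cartesian_product)
    also have "\<dots> = card (carrier_vec k :: 'a vec set)"
      using \<open>k > 0\<close> by (simp add: cardT card_carrier_vec power_eq_if)
    finally have "?g ` (T \<times> UNIV) = carrier_vec k"
      using T_carrier v by (intro card_subset_eq finite_carrier_vec) auto
    with w have "w \<in> ?g ` (T \<times> UNIV)" by simp
    then obtain t c where "t \<in> T" "w = t + c \<cdot>\<^sub>v v" by auto
    then show ?thesis using shift by metis
  qed
  define f where "f w = (THE c. w + c \<cdot>\<^sub>v v \<in> T)" for w
  have fI: "f w = c" if "w \<in> carrier_vec k" "w + c \<cdot>\<^sub>v v \<in> T" for w c
    unfolding f_def using that uniq by blast
  have f: "w + f w \<cdot>\<^sub>v v \<in> T" if "w \<in> carrier_vec k" for w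
    using ex[OF that] fI[OF that] by auto
  have f_add: "f (w + w') = f w + f w'" if w: "w \<in> carrier_vec k" "w' \<in> carrier_vec k" for w w'
  proof (rule fI)
    have "(w + f w \<cdot>\<^sub>v v) + (w' + f w' \<cdot>\<^sub>v v) \<in> T" by (intro T_add[OF f f] w)
    also have "(w + f w \<cdot>\<^sub>v v) + (w' + f w' \<cdot>\<^sub>v v) = w + w' + (f w + f w') \<cdot>\<^sub>v v"
      using w v by (intro eq_vecI) (auto simp: algebra_simps)
    finally show "w + w' + (f w + f w') \<cdot>\<^sub>v v \<in> T" .
  qed (use w in auto)
  have f_smult: "f (c \<cdot>\<^sub>v w) = c * f w" if w: "w \<in> carrier_vec k" for c w
  proof (rule fI)
    have "c \<cdot>\<^sub>v (w + f w \<cdot>\<^sub>v v) \<in> T" by (intro T_smult[OF f] w)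
    also have "c \<cdot>\<^sub>v (w + f w \<cdot>\<^sub>v v) = c \<cdot>\<^sub>v w + (c * f w) \<cdot>\<^sub>v v"
      using w v by (intro eq_vecI) (auto simp: algebra_simps)
    finally show "c \<cdot>\<^sub>v w + (c * f w) \<cdot>\<^sub>v v \<in> T" .
  qed (use w in auto)
  define a where "a = vec k (\<lambda>j. f (unit_vec k j))"
  have fa: "f w = a \<bullet> w" if "w \<in> carrier_vec k" for w
    unfolding a_def by (rule linear_functional_eq_scalar_prod[OF f_add f_smult that])
  have zero: "w + 0 \<cdot>\<^sub>v v = w" if "w \<in> carrier_vec k" for w
    using that v by (intro eq_vecI) auto
  show thesis
  proof (rule that)
    show "a \<in> carrier_vec k" by (simp add: a_def)
    \<comment> \<open>The value of \<open>f\<close> at \<open>v\<close> is -1, which shows that the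
      functional is not zero.\<close>
    have "v + (-1) \<cdot>\<^sub>v v = 0\<^sub>v k" using v by (intro eq_vecI) auto
    moreover have "0\<^sub>v k \<in> T" using T.zero_closed by (simp add: module_vec_simps)
    ultimately have "f v = -1" using v by (intro fI) auto
    then show "a \<noteq> 0\<^sub>v k" using fa[OF v(1)] v by auto
    show "T = {v \<in> carrier_vec k. a \<bullet> v = 0}"
    proof (intro equalityI subsetI)
      fix w assume "w \<in> T"
      then show "w \<in> {v \<in> carrier_vec k. a \<bullet> v = 0}"
        using fI[of w 0] zero[of w] fa[of w] T_carrier by auto
    next
      fix w assume "w \<in> {v \<in> carrier_vec k. a \<bullet> v = 0}"
      then show "w \<in> T" using f[of w] zero[of w] fa[of w] by auto
    qed
  qed
qed

section \<open>The space U: coordinates, linearity and size\<close>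

text \<open>The generic vector of \<open>U_space\<close> given by index instead of by list. Counting
  from 0, for j \<ge> 2 the entry \<open>x j\<close> sits at 2j - 1 and \<open>x j ^ q\<close> at
  2j.\<close>

definition U_vec :: "nat \<Rightarrow> nat \<Rightarrow> (nat \<Rightarrow> 'a) \<Rightarrow> 'a \<Rightarrow> 'a::field vec" where
  "U_vec q s x \<zeta> = vec (2 * s + 1) (\<lambda>l.
     if l = 0 then x 1 + \<zeta> else if l = 1 then x 1 ^ q else if l = 2 then x 1 ^ (q ^ 2)
     else if odd l then x (Suc l div 2) else x (l div 2) ^ q)"

lemma length_concat_pairs: "length (concat (map (\<lambda>j. [f j, g j]) [2..<n + 2])) = 2 * n"
  by (induction n) auto

lemma nth_concat_pairs:
  assumes "l < 2 * n"
  shows "concat (map (\<lambda>j. [f j, g j]) [2..<n + 2]) ! l =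
    (if even l then f (l div 2 + 2) else g (l div 2 + 2))"
  using assms
proof (induction n)
  case (Suc n)
  let ?c = "concat (map (\<lambda>j. [f j, g j]) [2..<n + 2])"
  have eq: "concat (map (\<lambda>j. [f j, g j]) [2..<Suc n + 2]) = ?c @ [f (n + 2), g (n + 2)]"
    by simp
  from Suc.prems consider "l < 2 * n" | "l = 2 * n" | "l = 2 * n + 1" by fastforce
  then show ?case
    unfolding eq nth_append length_concat_pairs by cases (simp_all only: Suc.IH, simp_all)
qed simp

lemma U_vec_eq_vec_of_list:
  assumes "s > 0"
  shows "U_vec q s x \<zeta> = vec_of_list ([x 1 + \<zeta>, x 1 ^ q, x 1 ^ (q ^ 2)]
        @ concat (map (\<lambda>j. [x j, x j ^ q]) [2..<s + 1]))" (is "_ = vec_of_list (?xs @ ?ys)")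
proof -
  \<comment> \<open>With \<open>s = n + 1\<close> the range \<open>[2..<s + 1]\<close> becomes
    \<open>[2..<n + 2]\<close>, which contributes \<open>2 * n\<close> entries after the first
    three.\<close>
  obtain n where s: "s = Suc n" using assms gr0_implies_Suc by blast
  have ys: "length ?ys = 2 * n"
    "l < 2 * n \<Longrightarrow> ?ys ! l = (if even l then x (l div 2 + 2) else x (l div 2 + 2) ^ q)" for l
    using length_concat_pairs[of x "\<lambda>j. x j ^ q" n] nth_concat_pairs[of l n x "\<lambda>j. x j ^ q"]
    by (simp_all add: s)
  show ?thesis
  proof (rule eq_vecI)
    show "dim_vec (U_vec q s x \<zeta>) = dim_vec (vec_of_list (?xs @ ?ys))"
      by (simp only: dim_vec_of_list length_append ys) (simp add: U_vec_def s)
    fix l assume "l < dim_vec (vec_of_list (?xs @ ?ys))"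
    then have l: "l < 3 + 2 * n" by (simp only: dim_vec_of_list length_append ys) simp
    have "(?xs @ ?ys) ! l = U_vec q s x \<zeta> $ l"
    proof (cases "l < 3")
      case True
      then have "l = 0 \<or> l = 1 \<or> l = 2" by auto
      then show ?thesis by (auto simp: U_vec_def s)
    next
      case False
      then obtain r where r: "l = r + 3" by (metis add.commute le_Suc_ex not_less)
      then have "(?xs @ ?ys) ! l = ?ys ! r" by (simp add: nth_append del: append_Cons)
      then show ?thesis using l ys(2)[of r] by (auto simp: U_vec_def s r elim!: evenE oddE)
    qed
    then show "U_vec q s x \<zeta> $ l = vec_of_list (?xs @ ?ys) $ l"
      by (simp only: vec_of_list_index)
  qed
qed

lemma U_space_eq_U_vec:
  "s > 0 \<Longrightarrow> U_space q s S = {U_vec q s x \<zeta> | x \<zeta>. \<zeta> \<in> S}"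
  by (simp only: U_space_def U_vec_eq_vec_of_list)

text \<open>The powers with exponents \<open>q\<close> and \<open>q ^ 2\<close> are additive and fix
  \<open>F\<close> pointwise, so every coordinate is F-linear in the parameters \<open>x\<close> and
  \<open>\<zeta>\<close>.\<close>

lemma subspace_U_space:
  fixes F S :: "'a::{field,finite} set"
  assumes q: "primepow q" "card (UNIV :: 'a set) = q ^ m"
    and F: "subfield F class_ring" "card F = q"
    and S: "VectorSpace.subspace (subfield_ring F) S self_module"
    and s: "s > 0"
  shows "VectorSpace.subspace (subfield_ring F) (U_space q s S) (module_vec TYPE('a) (2 * s + 1))"
proof -
  note vs = vectorspace_module_vec[OF F(1), of "2 * s + 1"]
  interpret S: submodule "subfield_ring F" S self_module
    using S by (simp add: VectorSpace.subspace_def)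
  have S_add: "x + y \<in> S" if "x \<in> S" "y \<in> S" for x y
    using S.m_closed that by (simp add: self_module_def)
  have S_zero: "0 \<in> S" using S.zero_closed by (simp add: self_module_def)
  have S_smult: "c * x \<in> S" if "c \<in> F" "x \<in> S" for c x
    using S.smult_closed[of c x] that by (simp add: self_module_def subfield_ring_def)
  have "q > 0" using q(1) by (simp add: primepow_gt_0_nat)
  note frob = field_power_primepow_add[OF q]
  have frob2: "(x + y) ^ (q ^ 2) = x ^ (q ^ 2) + y ^ (q ^ 2)" for x y :: 'a
    by (simp add: power2_eq_square power_mult frob)
  have F_pow: "c ^ q = c" if "c \<in> F" for c
    using subfield_power_card[OF F(1) that] F(2) by simp
  then have F_pow2: "c ^ (q ^ 2) = c" if "c \<in> F" for c
    using that by (simp add: power2_eq_square power_mult)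
  have "submodule (subfield_ring F) (U_space q s S) (module_vec TYPE('a) (2 * s + 1))"
  proof (rule submodule.intro)
    show "Module.module (subfield_ring F) (module_vec TYPE('a) (2 * s + 1))"
      using vs by (simp add: vectorspace_def)
    show "U_space q s S \<subseteq> carrier (module_vec TYPE('a) (2 * s + 1))"
      using U_space_carrier[OF s] by (simp add: module_vec_simps)
    \<comment> \<open>Positivity of \<open>q\<close> matters here: it gives
      \<open>0 ^ q = 0\<close>.\<close>
    have "0\<^sub>v (2 * s + 1) = U_vec q s (\<lambda>_. 0) 0"
      using \<open>q > 0\<close> by (intro eq_vecI) (auto simp: U_vec_def)
    then show "\<zero>\<^bsub>module_vec TYPE('a) (2 * s + 1)\<^esub> \<in> U_space q s S"
      using S_zero U_space_eq_U_vec[OF s, of q S] by (auto simp: module_vec_simps)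
  next
    fix v w assume "v \<in> U_space q s S" "w \<in> U_space q s S"
    then obtain x \<zeta> y \<eta> where *: "v = U_vec q s x \<zeta>" "w = U_vec q s y \<eta>" "\<zeta> \<in> S" "\<eta> \<in> S"
      using U_space_eq_U_vec[OF s, of q S] by auto
    have "v + w = U_vec q s (\<lambda>j. x j + y j) (\<zeta> + \<eta>)"
      unfolding * by (intro eq_vecI) (auto simp: U_vec_def frob frob2)
    then show "v \<oplus>\<^bsub>module_vec TYPE('a) (2 * s + 1)\<^esub> w \<in> U_space q s S"
      using S_add[OF *(3,4)] U_space_eq_U_vec[OF s, of q S] by (auto simp: module_vec_simps)
  next
    fix c v assume "c \<in> carrier (subfield_ring F)" and v: "v \<in> U_space q s S"
    then have c: "c \<in> F" by (simp add: subfield_ring_def)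
    from v obtain x \<zeta> where *: "v = U_vec q s x \<zeta>" "\<zeta> \<in> S"
      using U_space_eq_U_vec[OF s, of q S] by auto
    have "c \<cdot>\<^sub>v v = U_vec q s (\<lambda>j. c * x j) (c * \<zeta>)"
      unfolding * by (intro eq_vecI)
        (auto simp: U_vec_def power_mult_distrib F_pow[OF c] F_pow2[OF c] distrib_left)
    then show "c \<odot>\<^bsub>module_vec TYPE('a) (2 * s + 1)\<^esub> v \<in> U_space q s S"
      using S_smult[OF c *(2)] U_space_eq_U_vec[OF s, of q S] by (auto simp: module_vec_simps)
  qed
  then show ?thesis using vs by (simp add: VectorSpace.subspace_def)
qed

text \<open>The parameters can be recovered from the vector: Frobenius is injective, so the q-th
  powers determine all \<open>x j\<close>, and then the first entry determines
  \<open>\<zeta>\<close>.\<close>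

lemma card_U_space:
  fixes S :: "'a::{field,finite} set"
  assumes q: "primepow q" "card (UNIV :: 'a set) = q ^ m" and s: "s > 0"
  shows "card (U_space q s S) = card (UNIV :: 'a set) ^ s * card S"
proof -
  have power_inj: "x = y" if "x ^ q = y ^ q" for x y :: 'a
  proof -
    have "x ^ q = (x - y) ^ q + y ^ q"
      using field_power_primepow_add[OF q, of "x - y" y] by simp
    with that have "(x - y) ^ q = 0" by simp
    then show ?thesis by simp
  qed
  \<comment> \<open>Extensional functions remove the irrelevant values of \<open>x\<close> outside
    \<open>{1..s}\<close>, which would spoil injectivity.\<close>
  let ?P = "({1..s} \<rightarrow>\<^sub>E (UNIV :: 'a set)) \<times> S"
  let ?g = "\<lambda>(x, \<zeta>). U_vec q s x \<zeta>"
  have "U_space q s S = ?g ` ?P"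
  proof (intro equalityI subsetI)
    fix v assume "v \<in> U_space q s S"
    then obtain x \<zeta> where v: "v = U_vec q s x \<zeta>" "\<zeta> \<in> S"
      using U_space_eq_U_vec[OF s, of q S] by auto
    have "v = U_vec q s (restrict x {1..s}) \<zeta>"
      unfolding v using s by (intro eq_vecI) (auto simp: U_vec_def elim!: evenE oddE)
    with v(2) show "v \<in> ?g ` ?P"
      by (intro image_eqI[of _ _ "(restrict x {1..s}, \<zeta>)"]) auto
  qed (use U_space_eq_U_vec[OF s, of q S] in auto)
  moreover have "inj_on ?g ?P"
  proof (rule inj_onI, clarify)
    fix x y :: "nat \<Rightarrow> 'a" and \<zeta> \<eta>
    assume x: "x \<in> {1..s} \<rightarrow>\<^sub>E UNIV" and y: "y \<in> {1..s} \<rightarrow>\<^sub>E UNIV"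
      and eq: "U_vec q s x \<zeta> = U_vec q s y \<eta>"
    have nth: "U_vec q s x \<zeta> $ l = U_vec q s y \<eta> $ l" for l by (simp add: eq)
    \<comment> \<open>Entry 1 is \<open>x 1 ^ q\<close>; unlike entry 0 it is not disturbed by
      \<open>\<zeta>\<close>.\<close>
    have one: "x 1 = y 1" by (rule power_inj) (use nth[of 1] s in \<open>simp add: U_vec_def\<close>)
    have "x j = y j" if "j \<in> {1..s}" for j
    proof (cases "j = 1")
      case False
      with that have "2 * j < 2 * s + 1" "2 * j \<noteq> 0" "2 * j \<noteq> 1" "2 * j \<noteq> 2" by auto
      with nth[of "2 * j"] have "x j ^ q = y j ^ q" by (simp add: U_vec_def)
      then show ?thesis by (rule power_inj)
    qed (use one in simp)
    then have "x = y" using x y by (intro PiE_ext)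
    moreover have "\<zeta> = \<eta>" using nth[of 0] one by (simp add: U_vec_def)
    ultimately show "x = y \<and> \<zeta> = \<eta>" by simp
  qed
  ultimately have "card (U_space q s S) = card ?P" by (simp add: card_image)
  then show ?thesis by (simp add: card_cartesian_product card_PiE)
qed

section \<open>The image of U under a functional\<close>

text \<open>Choose the block of coordinates that contains a nonzero entry of \<open>a\<close> and
  vary only the parameter of this block. The entries of \<open>a\<close> there become the
  coefficients.\<close>

lemma U_space_contains_q_polynomial_image:
  fixes S :: "'a::{field,finite} set"
  assumes q: "q > 0" and s: "s > 0" and "0 \<in> S"
    and a: "a \<in> carrier_vec (2 * s + 1)" "a \<noteq> 0\<^sub>v (2 * s + 1)"
  obtains b c d where "b \<noteq> 0 \<or> c \<noteq> 0 \<or> d \<noteq> 0"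
    and "\<And>t. b * t + c * t ^ q + d * t ^ (q ^ 2) \<in> (\<lambda>v. a \<bullet> v) ` U_space q s S"
proof -
  define e where "e j t = U_vec q s (\<lambda>i. if i = j then t else 0) 0" for j and t :: 'a
  have e: "e j t \<in> U_space q s S" for j t
    using U_space_eq_U_vec[OF s, of q S] \<open>0 \<in> S\<close> by (auto simp: e_def)
  \<comment> \<open>Only the positions in the block of \<open>j\<close> contribute to the scalar
    product.\<close>
  have prod: "a \<bullet> e j t = (\<Sum>l\<in>L. a $ l * e j t $ l)"
    if "L \<subseteq> {0..<2 * s + 1}" "\<And>l. l \<in> {0..<2 * s + 1} - L \<Longrightarrow> e j t $ l = 0" for L j t
    using that unfolding scalar_prod_def
    by (intro sum.mono_neutral_right) (auto simp: e_def U_vec_def)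
  obtain l where l: "l < 2 * s + 1" "a $ l \<noteq> 0"
    using a by (metis carrier_vecD eq_vecI index_zero_vec(1) index_zero_vec(2))
  show thesis
  proof (cases "l < 3")
    case True
    show thesis
    proof (rule that)
      have "l = 0 \<or> l = 1 \<or> l = 2" using True by auto
      then show "a $ 0 \<noteq> 0 \<or> a $ 1 \<noteq> 0 \<or> a $ 2 \<noteq> 0" using l by auto
      fix t
      have "a \<bullet> e 1 t = (\<Sum>l\<in>{0, 1, 2}. a $ l * e 1 t $ l)"
        using s q by (intro prod) (auto simp: e_def U_vec_def elim!: evenE oddE)
      also have "\<dots> = a $ 0 * t + a $ 1 * t ^ q + a $ 2 * t ^ (q ^ 2)"
        using s by (simp add: e_def U_vec_def)
      finally show "a $ 0 * t + a $ 1 * t ^ q + a $ 2 * t ^ (q ^ 2) \<in> (\<lambda>v. a \<bullet> v) ` U_space q s S"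
        using e by (metis image_eqI)
    qed
  next
    case False
    \<comment> \<open>This is the block of position \<open>l\<close>, as entries 2j - 1 and 2j
      belong to \<open>x j\<close>.\<close>
    define j where "j = Suc l div 2"
    have j: "2 \<le> j" "j \<le> s" "l = 2 * j - 1 \<or> l = 2 * j"
      using False l(1) by (auto simp: j_def)
    show thesis
    proof (rule that)
      \<comment> \<open>A block with j \<ge> 2 has two entries only, so the coefficient of
        \<open>t ^ (q ^ 2)\<close> is 0.\<close>
      show "a $ (2 * j - 1) \<noteq> 0 \<or> a $ (2 * j) \<noteq> 0 \<or> (0 :: 'a) \<noteq> 0" using j(3) l(2) by auto
      fix t
      have "a \<bullet> e j t = (\<Sum>l\<in>{2 * j - 1, 2 * j}. a $ l * e j t $ l)"
        using j(1,2) q by (intro prod) (auto simp: e_def U_vec_def elim!: evenE oddE)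
      also have "\<dots> = a $ (2 * j - 1) * t + a $ (2 * j) * t ^ q + 0 * t ^ (q ^ 2)"
      proof -
        have "2 * j - 1 < 2 * s + 1" "2 * j - 1 \<noteq> 0" "2 * j - 1 \<noteq> 1" "2 * j - 1 \<noteq> 2"
          "odd (2 * j - 1)" "Suc (2 * j - 1) div 2 = j" "2 * j - 1 \<noteq> 2 * j"
          using j(1,2) by auto
        moreover have "2 * j < 2 * s + 1" "2 * j \<noteq> 0" "2 * j \<noteq> 1" "2 * j \<noteq> 2"
          using j(1,2) by auto
        ultimately show ?thesis by (simp add: e_def U_vec_def)
      qed
      finally show "a $ (2 * j - 1) * t + a $ (2 * j) * t ^ q + 0 * t ^ (q ^ 2)
          \<in> (\<lambda>v. a \<bullet> v) ` U_space q s S"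
        using e by (metis image_eqI)
    qed
  qed
qed

text \<open>The fibre count for the additive polynomial on the whole field, combined with the root
  bound. Keeping \<open>q ^ 2\<close> as a factor on the right also covers m < 2.\<close>

lemma card_image_U_space_ge:
  fixes S :: "'a::{field,finite} set"
  assumes q: "primepow q" "card (UNIV :: 'a set) = q ^ m"
    and s: "s > 0" and "0 \<in> S"
    and a: "a \<in> carrier_vec (2 * s + 1)" "a \<noteq> 0\<^sub>v (2 * s + 1)"
  shows "q ^ m \<le> card ((\<lambda>v. a \<bullet> v) ` U_space q s S) * q ^ 2"
proof -
  have q2: "q \<ge> 2" using primepow_gt_Suc_0[OF q(1)] by simp
  obtain b c d where nz: "b \<noteq> 0 \<or> c \<noteq> 0 \<or> d \<noteq> 0"
    and im: "\<And>t. b * t + c * t ^ q + d * t ^ (q ^ 2) \<in> (\<lambda>v. a \<bullet> v) ` U_space q s S"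
    using U_space_contains_q_polynomial_image[OF _ s \<open>0 \<in> S\<close> a] q2
    by (metis gr_zeroI not_numeral_le_zero)
  let ?f = "\<lambda>t. b * t + c * t ^ q + d * t ^ (q ^ 2)"
  have add: "?f (x + y) = ?f x + ?f y" for x y
    by (simp add: power2_eq_square power_mult field_power_primepow_add[OF q] algebra_simps)
  have "q ^ m = card (range ?f) * card {x. ?f x = 0}"
    using class_ring.card_carrier_eq_image_times_kernel[of ?f] add q(2) by simp
  also have "\<dots> \<le> card ((\<lambda>v. a \<bullet> v) ` U_space q s S) * q ^ 2"
    using im card_roots_q_polynomial_le[OF q2 nz] finite_subset[OF U_space_carrier[OF s] finite_carrier_vec]
    by (intro mult_mono card_mono) auto
  finally show ?thesis .
qed

section \<open>Bounding the weight of a hyperplane\<close>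

theorem theorem5p12:
  fixes q m s k i :: nat
    and F S :: "'a::{field,finite} set"
    and T :: "'a vec set"
  assumes "primepow q" and "m > 0" and "s > 0" and "k = 2 * s + 1"
    and "card (UNIV :: 'a set) = q ^ m"
    and "subfield F class_ring" and "card F = q"
    and "VectorSpace.subspace (subfield_ring F) S self_module"
    and "dim_over (subfield_ring F) self_module S = i"
    and "is_hyperplane k T"
  shows "real (weight F k (U_space q s S) T) \<in>
    {real m * (real k - 3) / 2 + real i,
     real m * (real k - 3) / 2 + real i + 1,
     real m * (real k - 3) / 2 + real i + 2}"
proof -
  let ?V = "module_vec TYPE('a) k" and ?K = "subfield_ring F" and ?U = "U_space q s S"
  define w where "w = weight F k ?U T"
  have q1: "q > 1" using primepow_gt_Suc_0[OF assms(1)] by simp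
  have cardK: "card (carrier ?K) = q" using assms(7) by (simp add: subfield_ring_def)
  obtain a where a: "a \<in> carrier_vec k" "a \<noteq> 0\<^sub>v k" and T: "T = {v \<in> carrier_vec k. a \<bullet> v = 0}"
    using hyperplane_eq_orthogonal_complement[OF assms(10)] assms(4) by auto
  have U_carrier: "?U \<subseteq> carrier_vec k" using U_space_carrier[OF assms(3)] assms(4) by simp
  then have finU: "finite ?U" using finite_carrier_vec finite_subset by blast
  note vs = vectorspace_module_vec[OF assms(6), of k]
  have subU: "VectorSpace.subspace ?K ?U ?V"
    using subspace_U_space[OF assms(1,5,6,7,8,3)] assms(4) by simp
  interpret U: submodule ?K ?U ?V using subU by (simp add: VectorSpace.subspace_def)
  interpret S: submodule ?K S self_module using assms(8) by (simp add: VectorSpace.subspace_def)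
  \<comment> \<open>The intersection is the kernel of \<open>v \<mapsto> a \<bullet> v\<close> on
    \<open>?U\<close>, which is the form the fibre count needs.\<close>
  have UT: "?U \<inter> T = {v \<in> ?U. a \<bullet> v = 0}" using U_carrier T by auto
  have "submodule ?K (?U \<inter> T) ?V"
  proof (rule submodule.intro)
    show "Module.module ?K ?V" by (rule U.module)
    show "?U \<inter> T \<subseteq> carrier ?V" using U.subset by blast
    show "\<zero>\<^bsub>?V\<^esub> \<in> ?U \<inter> T"
      using U.zero_closed a(1) by (simp add: T module_vec_simps)
    show "v \<oplus>\<^bsub>?V\<^esub> w \<in> ?U \<inter> T" if "v \<in> ?U \<inter> T" "w \<in> ?U \<inter> T" for v w
      using that U.m_closed[of v w] a(1)
      by (simp add: T module_vec_simps scalar_prod_add_distrib[of a k])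
    show "c \<odot>\<^bsub>?V\<^esub> v \<in> ?U \<inter> T" if "c \<in> carrier ?K" "v \<in> ?U \<inter> T" for c v
      using that U.smult_closed[of c v] a(1) by (simp add: T module_vec_simps)
  qed
  then have "VectorSpace.subspace ?K (?U \<inter> T) ?V" using vs by (simp add: VectorSpace.subspace_def)
  then have card_UT: "card (?U \<inter> T) = q ^ w"
    using card_subspace_eq_power_dim_over[OF vs, of "?U \<inter> T"] finU cardK
    by (simp add: w_def weight_def)
  have "card S = q ^ i"
    using card_subspace_eq_power_dim_over[OF vectorspace_self_module[OF assms(6)] assms(8)] cardK assms(9)
    by simp
  then have card_U: "card ?U = q ^ (m * s + i)"
    using card_U_space[OF assms(1,5,3), of S] assms(5) by (simp add: power_mult power_add)
  interpret VU: vectorspace ?K "?V\<lparr>carrier := ?U\<rparr>"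
    by (rule vectorspace.subspace_is_vs[OF vs subU])
  let ?I = "(\<lambda>v. a \<bullet> v) ` ?U"
  have count: "q ^ (m * s + i) = card ?I * q ^ w"
    using VU.card_carrier_eq_image_times_kernel[of "\<lambda>v. a \<bullet> v"] finU card_U card_UT U_carrier a(1)
    by (simp add: UT module_vec_simps subset_iff scalar_prod_add_distrib[of a k])
  \<comment> \<open>A bound on the image from above bounds the kernel, and so \<open>w\<close>, from
    below.\<close>
  have "card ?I \<le> q ^ m" using card_mono[of UNIV ?I] assms(5) by simp
  then have "q ^ (m * s + i) \<le> q ^ (m + w)"
    unfolding count unfolding power_add by (rule mult_le_mono1)
  then have lower: "m * s + i \<le> m + w" by (rule power_le_imp_le_exp[OF q1])
  have "0 \<in> S" using S.zero_closed by (simp add: self_module_def)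
  then have "q ^ m \<le> card ?I * q ^ 2"
    using card_image_U_space_ge[OF assms(1,5,3)] a assms(4) by simp
  \<comment> \<open>Multiplying by \<open>q ^ w\<close> turns \<open>card ?I\<close> into the known
    size of \<open>?U\<close>, so exponents can be compared.\<close>
  then have "q ^ m * q ^ w \<le> (card ?I * q ^ 2) * q ^ w" by (rule mult_le_mono1)
  also have "\<dots> = card ?I * q ^ w * q ^ 2" by simp
  also have "\<dots> = q ^ (m * s + i + 2)" by (simp only: count[symmetric] power_add)
  finally have "q ^ (m + w) \<le> q ^ (m * s + i + 2)" by (simp only: power_add)
  then have upper: "m + w \<le> m * s + i + 2" by (rule power_le_imp_le_exp[OF q1])
  \<comment> \<open>Leaving \<open>m\<close> on the left avoids subtraction of natural numbers until
    the passage to reals.\<close>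
  have "m + w = m * s + i \<or> m + w = m * s + i + 1 \<or> m + w = m * s + i + 2"
    using lower upper by linarith
  then have "real m + real w = real m * real s + real i \<or>
      real m + real w = real m * real s + real i + 1 \<or> real m + real w = real m * real s + real i + 2"
    by (metis of_nat_1 of_nat_add of_nat_mult of_nat_numeral)
  \<comment> \<open>With \<open>k = 2 * s + 1\<close> the fraction (k - 3)/2 equals s - 1.\<close>
  moreover have "real m * (real k - 3) / 2 = real m * real s - real m"
    using assms(4) by (simp add: field_simps)
  ultimately show ?thesis unfolding w_def[symmetric] insert_iff by argo
qed
end
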